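(* Let $m,n$ be non-zero integers. Then the Diophantine equation $$T^2=m(X_1^5-X_2^5)+n^2(X_3^5-X_4^5)$$ has a solution in co-prime polynomials $X_1,X_2,X_3,X_4,T\in\mathbb{Z}[u]$. In particular, this equation has infinitely many primitive solutions in integers.
   Context: A primitive integer solution is one with $T,X_1,\dots,X_4\in\mathbb{Z}$ and $\gcd(X_1,X_2,X_3,X_4)=1$. *)

theory Defs
  imports "HOL-Computational_Algebra.Computational_Algebra"
begin

text \<open>
  Both domains of the variables, \<open>\<int>\<close> and \<open>\<int>[u]\<close>, are commutative rings
  with gcd, so the notions below are polymorphic in the ring. The coefficients \<open>m\<close> and \<open>n\<close>
  are always integers.
\<close>

definition quintic_solution ::
  "int \<Rightarrow> int \<Rightarrow> 'a::comm_ring_1 \<Rightarrow> 'a \<Rightarrow> 'a \<Rightarrow> 'a \<Rightarrow> 'a \<Rightarrow> bool" where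
  "quintic_solution m n T X1 X2 X3 X4 \<longleftrightarrow>
     T ^ 2 = of_int m * (X1 ^ 5 - X2 ^ 5) + (of_int n) ^ 2 * (X3 ^ 5 - X4 ^ 5)"

text \<open>
  Joint (not pairwise) coprimality. On \<open>int poly\<close> the gcd is the one of the factorial
  ring \<open>\<int>[u]\<close>, so a common integer factor of all coefficients is excluded as well.
  Including \<open>T\<close> would make no difference: in a factorial ring, a prime dividing
  \<open>X1, \<dots>, X4\<close> for a solution divides \<open>T ^ 2\<close> and hence \<open>T\<close>.
\<close>

definition coprime4 :: "'a::semiring_gcd \<Rightarrow> 'a \<Rightarrow> 'a \<Rightarrow> 'a \<Rightarrow> bool" where
  "coprime4 X1 X2 X3 X4 \<longleftrightarrow> gcd X1 (gcd X2 (gcd X3 X4)) = 1"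

text \<open>
  Excludes the obvious solutions, in which a difference of fifth powers vanishes
  (such as \<open>X1 = X2\<close>, \<open>X3 = 1\<close>, \<open>X4 = 0\<close>, \<open>T = n\<close>) or both sides are zero
  (such as \<open>X1 = X4\<close>, \<open>X2 = X3\<close>, \<open>T = 0\<close> for \<open>m = n ^ 2\<close>).
\<close>

definition nontrivial :: "'a::zero \<Rightarrow> 'a \<Rightarrow> 'a \<Rightarrow> 'a \<Rightarrow> 'a \<Rightarrow> bool" where
  "nontrivial T X1 X2 X3 X4 \<longleftrightarrow> T \<noteq> 0 \<and> X1 \<noteq> X2 \<and> X3 \<noteq> X4"

end

theory Submission
  imports Defs
begin

text \<open>
  Put \<open>X1, X2 = u \<mp> n\<^sup>2 e\<close> and \<open>X3, X4 = u \<plusminus> m e\<close>. The \<open>u ^ 4\<close> terms cancel, and with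
  \<open>q = m (m\<^sup>2 - n\<^sup>4)\<close> the right-hand side is
  \<open>2 n\<^sup>2 q e\<^sup>3 (10 u\<^sup>2 + (m\<^sup>2 + n\<^sup>4) e\<^sup>2)\<close>. For \<open>e = 20 q f\<^sup>2\<close> it is a square as soon as
  \<open>(10 u)\<^sup>2 + 4000 q\<^sup>2 (m\<^sup>2 + n\<^sup>4) f\<^sup>4\<close> is one, and the latter equals \<open>(10 u + 20)\<^sup>2\<close> for
  \<open>u = 10 q\<^sup>2 (m\<^sup>2 + n\<^sup>4) f\<^sup>4 - 1\<close>. Since \<open>u\<close> is \<open>-1\<close> modulo every prime factor of \<open>X3 - X4 = 2 m e\<close>,
  \<open>X3\<close> and \<open>X4\<close> are coprime. This degenerates only for \<open>m = \<plusminus> n\<^sup>2\<close>, where \<open>X4\<^sup>5\<close> can be cancelled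
  against \<open>X1\<^sup>5\<close> or \<open>X2\<^sup>5\<close>; with the other of these two zero, \<open>X3 = f\<^sup>2\<close> gives
  \<open>T = n f\<^sup>5\<close>.
\<close>

definition fam_q :: "int \<Rightarrow> int \<Rightarrow> int" where
  "fam_q m n = m * (m ^ 2 - n ^ 4)"

text \<open>The ring is left open so that the same formulas serve twice: at
  \<open>f = [:0, 1:]\<close>, the indeterminate, for the polynomial solution, and at integers
  \<open>f\<close> for the infinite family.\<close>

definition fam_e :: "int \<Rightarrow> int \<Rightarrow> 'a::comm_ring_1 \<Rightarrow> 'a" where
  "fam_e m n f = 20 * of_int (fam_q m n) * f ^ 2"

definition fam_u :: "int \<Rightarrow> int \<Rightarrow> 'a::comm_ring_1 \<Rightarrow> 'a" where
  "fam_u m n f = 10 * of_int (fam_q m n) ^ 2 * of_int (m ^ 2 + n ^ 4) * f ^ 4 - 1"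

definition fam_X12 :: "int \<Rightarrow> int \<Rightarrow> 'a::comm_ring_1 \<Rightarrow> 'a \<times> 'a" where
  "fam_X12 m n f =
     (if m = n ^ 2 then (1, 0) else if m = - (n ^ 2) then (0, 1)
      else (fam_u m n f - of_int n ^ 2 * fam_e m n f, fam_u m n f + of_int n ^ 2 * fam_e m n f))"

definition fam_X34 :: "int \<Rightarrow> int \<Rightarrow> 'a::comm_ring_1 \<Rightarrow> 'a \<times> 'a" where
  "fam_X34 m n f =
     (if m = n ^ 2 \<or> m = - (n ^ 2) then (f ^ 2, 1)
      else (fam_u m n f + of_int m * fam_e m n f, fam_u m n f - of_int m * fam_e m n f))"

definition fam_T :: "int \<Rightarrow> int \<Rightarrow> 'a::comm_ring_1 \<Rightarrow> 'a" where
  "fam_T m n f =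
     (if m = n ^ 2 \<or> m = - (n ^ 2) then of_int n * f ^ 5
      else 20 * of_int n * of_int (fam_q m n) * f * fam_e m n f * (fam_u m n f + 2))"

lemma diff_fifth_powers:
  fixes a b :: "'a::comm_ring_1"
  shows "(a + b) ^ 5 - (a - b) ^ 5 = 2 * b * (5 * a ^ 4 + 10 * a ^ 2 * b ^ 2 + b ^ 4)"
  by (simp add: eval_nat_numeral algebra_simps)

lemma fam_square:
  fixes m n q e u f :: "'a::comm_ring_1"
  assumes q: "q = m * (m ^ 2 - n ^ 4)"
    and e: "e = 20 * q * f ^ 2"
    and u: "u = 10 * q ^ 2 * (m ^ 2 + n ^ 4) * f ^ 4 - 1"
  shows "(20 * n * q * f * e * (u + 2)) ^ 2 =
     m * ((u - n ^ 2 * e) ^ 5 - (u + n ^ 2 * e) ^ 5) +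
     n ^ 2 * ((u + m * e) ^ 5 - (u - m * e) ^ 5)" (is "_ = ?R")
proof -
  have "?R = m * - (2 * (n ^ 2 * e) * (5 * u ^ 4 + 10 * u ^ 2 * (n ^ 2 * e) ^ 2 + (n ^ 2 * e) ^ 4))
      + n ^ 2 * (2 * (m * e) * (5 * u ^ 4 + 10 * u ^ 2 * (m * e) ^ 2 + (m * e) ^ 4))"
    unfolding diff_fifth_powers[symmetric] by simp
  also have "\<dots> = 2 * n ^ 2 * q * e ^ 3 * (10 * u ^ 2 + (m ^ 2 + n ^ 4) * e ^ 2)"
    unfolding q by (simp add: eval_nat_numeral algebra_simps)
  also have "\<dots> = 4 * n ^ 2 * q ^ 2 * f ^ 2 * e ^ 2 *
      ((10 * u) ^ 2 + 400 * (10 * q ^ 2 * (m ^ 2 + n ^ 4) * f ^ 4))"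
    unfolding e by (simp add: eval_nat_numeral algebra_simps)
  also have "10 * q ^ 2 * (m ^ 2 + n ^ 4) * f ^ 4 = u + 1"
    by (simp add: u)
  also have "4 * n ^ 2 * q ^ 2 * f ^ 2 * e ^ 2 * ((10 * u) ^ 2 + 400 * (u + 1)) =
      (20 * n * q * f * e * (u + 2)) ^ 2"
    by (simp add: power2_eq_square algebra_simps)
  finally show ?thesis ..
qed

lemma fam_solution:
  "quintic_solution m n (fam_T m n f) (fst (fam_X12 m n f)) (snd (fam_X12 m n f))
     (fst (fam_X34 m n f)) (snd (fam_X34 m n f))"
proof (cases "m = n ^ 2 \<or> m = - (n ^ 2)")
  case True
  then show ?thesis
    by (auto simp: quintic_solution_def fam_T_def fam_X12_def fam_X34_def
        power_mult_distrib algebra_simps simp flip: power_mult)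
next
  case False
  then show ?thesis
    using fam_square[of "of_int (fam_q m n)" "of_int m" "of_int n" "fam_e m n f" f "fam_u m n f"]
    by (simp add: quintic_solution_def fam_T_def fam_X12_def fam_X34_def
        fam_e_def fam_u_def fam_q_def)
qed

lemma fam_coprime:
  fixes f :: "'a::ring_gcd"
  shows "coprime (fst (fam_X34 m n f)) (snd (fam_X34 m n f))"
proof (cases "m = n ^ 2 \<or> m = - (n ^ 2)")
  case True
  then show ?thesis
    by (simp add: fam_X34_def)
next
  case False
  let ?m = "of_int m :: 'a" and ?q = "of_int (fam_q m n) :: 'a"
  \<comment> \<open>\<open>w\<close> is the cofactor for which \<open>x + 1 = z * w\<close>.\<close>
  define z where "z = 10 * ?q * f ^ 2"
  define w where "w = ?q * of_int (m ^ 2 + n ^ 4) * f ^ 2 + 2 * ?m"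
  define x where "x = fam_u m n f + ?m * fam_e m n f"
  define y where "y = fam_u m n f - ?m * fam_e m n f"
  have x: "x = z * w - 1"
    by (simp add: x_def z_def w_def fam_u_def fam_e_def eval_nat_numeral algebra_simps)
  have diff: "x - y = 40 * ?m * ?q * f ^ 2"
    by (simp add: x_def y_def fam_e_def algebra_simps)
  \<comment> \<open>The ring need not be factorial, so prime factors of \<open>x - y\<close> are
    replaced by a power of \<open>z\<close>; the cube absorbs 40, \<open>m\<close>, \<open>q\<close>
    and \<open>f ^ 2\<close> together.\<close>
  have "z ^ 3 = (x - y) * (25 * of_int (m ^ 2 - n ^ 4) * ?q * f ^ 4)"
    unfolding diff z_def by (simp add: fam_q_def eval_nat_numeral algebra_simps)
  then have diff_dvd: "x - y dvd z ^ 3"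
    by simp
  have "coprime x y"
  proof (rule coprimeI)
    fix c assume c: "c dvd x" "c dvd y"
    then have "c dvd z ^ 3"
      using diff_dvd dvd_diff dvd_trans by blast
    then have "c dvd (z * w) ^ 3"
      by (simp add: power_mult_distrib)
    \<comment> \<open>Expanding \<open>(x + 1) ^ 3\<close> leaves 1 modulo \<open>x\<close>, so
      \<open>c\<close> divides 1.\<close>
    moreover have "(z * w) ^ 3 = x * (x ^ 2 + 3 * x + 3) + 1"
      unfolding x by (simp add: eval_nat_numeral algebra_simps)
    ultimately show "is_unit c"
      using c(1) by (metis dvd_add_right_iff dvd_mult2)
  qed
  then show ?thesis
    using False by (simp add: fam_X34_def x_def y_def)
qed

lemma coprime4_if_coprime:
  fixes X1 X2 X3 X4 :: "'a::semiring_gcd"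
  assumes "coprime X3 X4"
  shows "coprime4 X1 X2 X3 X4"
  using assms by (simp add: coprime4_def coprime_iff_gcd_eq_1)

lemma fam_q_neq_0:
  assumes "m \<noteq> 0" and "m \<noteq> n ^ 2" and "m \<noteq> - (n ^ 2)"
  shows "fam_q m n \<noteq> 0"
proof -
  have "fam_q m n = m * ((m - n ^ 2) * (m + n ^ 2))"
    by (simp add: fam_q_def eval_nat_numeral algebra_simps)
  then show ?thesis
    using assms by (simp add: eq_neg_iff_add_eq_0)
qed

text \<open>\<open>f ^ 2 \<noteq> 1\<close> separates \<open>X3\<close> from \<open>X4\<close> when
  \<open>m\<close> is plus or minus \<open>n ^ 2\<close>. Otherwise \<open>T\<close> has the factor
  \<open>fam_u m n f + 2\<close>, which is 1 modulo 10 and hence nonzero when 10 is not a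
  unit.\<close>

lemma fam_nontrivial:
  fixes f :: "'a::{idom, ring_char_0}"
  assumes "m \<noteq> 0" "n \<noteq> 0" "f \<noteq> 0" "f ^ 2 \<noteq> 1" "\<not> 10 dvd (1::'a)"
  shows "nontrivial (fam_T m n f) (fst (fam_X12 m n f)) (snd (fam_X12 m n f))
     (fst (fam_X34 m n f)) (snd (fam_X34 m n f))"
proof (cases "m = n ^ 2 \<or> m = - (n ^ 2)")
  case True
  then show ?thesis
    using assms by (auto simp: nontrivial_def fam_T_def fam_X12_def fam_X34_def)
next
  case False
  then have q: "fam_q m n \<noteq> 0"
    using fam_q_neq_0 assms by blast
  then have e: "fam_e m n f \<noteq> 0"
    using assms by (simp add: fam_e_def)
  have ne: "a - b \<noteq> a + b" "a + b \<noteq> a - b" if "b \<noteq> 0" for a b :: 'a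
    using that by (simp_all add: diff_eq_eq eq_diff_eq add.assoc flip: mult_2)
  have u: "fam_u m n f + 2 \<noteq> 0"
  proof
    assume "fam_u m n f + 2 = 0"
    then have "1 = 10 * - (of_int (fam_q m n) ^ 2 * of_int (m ^ 2 + n ^ 4) * f ^ 4)"
      by (simp add: fam_u_def algebra_simps eq_neg_iff_add_eq_0)
    then show False
      using assms(5) dvd_triv_left by metis
  qed
  show ?thesis
    using False q e u ne assms by (simp add: nontrivial_def fam_T_def fam_X12_def fam_X34_def)
qed

text \<open>Treats both cases at once, to show that the polynomial solution is not constant and that
  distinct integers \<open>f \<ge> 2\<close> give distinct solutions.\<close>

lemma fam_X34_diff:
  assumes "m \<noteq> 0"
  obtains c d :: int where "c \<noteq> 0" and
    "\<And>f :: 'a::comm_ring_1. fst (fam_X34 m n f) - snd (fam_X34 m n f) = of_int c * f ^ 2 + of_int d"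
proof (cases "m = n ^ 2 \<or> m = - (n ^ 2)")
  case True
  then show ?thesis
    using that[of 1 "-1"] by (simp add: fam_X34_def)
next
  case False
  then show ?thesis
    using that[of "40 * m * fam_q m n" 0] fam_q_neq_0[of m n] assms
    by (simp add: fam_X34_def fam_e_def algebra_simps)
qed

lemma fam_degree:
  assumes "m \<noteq> 0"
  shows "\<exists>X \<in> {fst (fam_X34 m n [:0, 1:]), snd (fam_X34 m n [:0, 1:])} :: int poly set. degree X > 0"
proof (rule ccontr)
  let ?X3 = "fst (fam_X34 m n [:0, 1:]) :: int poly" and ?X4 = "snd (fam_X34 m n [:0, 1:]) :: int poly"
  assume "\<not> ?thesis"
  then have "degree (?X3 - ?X4) \<le> 0"
    by (intro degree_diff_le) auto
  moreover obtain c d :: int where "c \<noteq> 0" and "?X3 - ?X4 = of_int c * [:0, 1:] ^ 2 + of_int d"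
    using fam_X34_diff[OF assms] by metis
  ultimately show False
    by (simp add: of_int_poly power2_eq_square)
qed

theorem theorem4p1:
  fixes m n :: int
  assumes "m \<noteq> 0" and "n \<noteq> 0"
  shows "(\<exists>T X1 X2 X3 X4 :: int poly.
            quintic_solution m n T X1 X2 X3 X4 \<and>
            coprime4 X1 X2 X3 X4 \<and>
            nontrivial T X1 X2 X3 X4 \<and>
            (\<exists>X \<in> {X1, X2, X3, X4}. degree X > 0))
       \<and> infinite {(T :: int, X1, X2, X3, X4).
            quintic_solution m n T X1 X2 X3 X4 \<and>
            coprime4 X1 X2 X3 X4 \<and>
            nontrivial T X1 X2 X3 X4}"
    (is "?poly \<and> infinite ?S")
proof
  have "\<not> (10 :: int poly) dvd 1"
    \<comment> \<open>The witness 0 is the index of the constant coefficient 1, which 10 does not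
      divide.\<close>
    by (auto simp: numeral_poly const_poly_dvd_iff intro!: exI[of _ 0])
  then show ?poly
    using fam_solution fam_nontrivial[of m n "[:0, 1:] :: int poly"] assms
      coprime4_if_coprime[OF fam_coprime] fam_degree[of m n]
    by (intro exI conjI) (auto simp: power2_eq_square one_pCons)
next
  define sol :: "int \<Rightarrow> int \<times> int \<times> int \<times> int \<times> int" where
    "sol f = (fam_T m n f, fst (fam_X12 m n f), snd (fam_X12 m n f),
      fst (fam_X34 m n f), snd (fam_X34 m n f))" for f
  obtain c d :: int where "c \<noteq> 0" and
    diff: "\<And>f :: int. fst (fam_X34 m n f) - snd (fam_X34 m n f) = of_int c * f ^ 2 + of_int d"
    using fam_X34_diff[OF assms(1)] by metis
  \<comment> \<open>Starting at 2 makes squaring injective and excludes \<open>f = 0\<close> and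
    \<open>f ^ 2 = 1\<close>.\<close>
  have "inj_on sol {2..}"
  proof (rule inj_onI)
    fix f g :: int
    assume "f \<in> {2..}" "g \<in> {2..}" "sol f = sol g"
    then have "c * f ^ 2 + d = c * g ^ 2 + d"
      using diff[of f] diff[of g] by (auto simp: sol_def)
    with \<open>c \<noteq> 0\<close> \<open>f \<in> {2..}\<close> \<open>g \<in> {2..}\<close> show "f = g"
      by (simp add: power2_eq_iff_nonneg)
  qed
  then have "infinite (sol ` {2..})"
    by (simp add: finite_image_iff infinite_Ici)
  moreover have "sol ` {2..} \<subseteq> ?S"
  proof (rule image_subsetI)
    fix f :: int assume "f \<in> {2..}"
    then show "sol f \<in> ?S"
      using fam_solution[of m n f] fam_nontrivial[of m n f] assms
        coprime4_if_coprime[OF fam_coprime[of m n f]]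
      by (simp add: sol_def power2_eq_1_iff case_prod_beta)
  qed
  ultimately show "infinite ?S"
    using infinite_super by blast
qed

end
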